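(* Suppose that $(P)$ satisfies the local Farkas–Minkowski constraint qualification (LFMCQ) at $\widehat{x}\in S$. Then $\widehat{x}$ is a weak efficient solution for $(P)$ if and only if $(P)$ satisfies the weak KKT condition at $\widehat{x}$.
   Context: Setting: $p\geq 2$, $I:=\{1,\ldots,p\}$; $f_i:\mathbb{R}^n\to\mathbb{R}$ ($i\in I$) are finite-valued convex functions; $T$ is an infinite index set; for each $t\in T$, $g_t:\mathbb{R}^n\to\mathbb{R}\cup\{+\infty\}$ is a lower semicontinuous proper convex function. Problem $(P)$: minimize $f(x):=(f_1(x),\ldots,f_p(x))$ subject to $g_t(x)\le 0$, $t\in T$, with feasible set $S:=\{x\in\mathbb{R}^n\mid g_t(x)\le 0\ \forall t\in T\}$ assumed nonempty. $\widehat{x}\in S$ is a weak efficient solution of $(P)$ if there is no $x\in S$ with $f_i(x)<f_i(\widehat{x})$ for all $i\in I$. Notation: $\partial$ is the Fenchel–Moreau subdifferential; $T(\widehat{x}):=\{t\in T\mid g_t(\widehat{x})=0\}$; $G(\widehat{x}):=\bigcup_{t\in T(\widehat{x})}\partial g_t(\widehat{x})$; $G_\ast(\widehat{x}):=\operatorname{cone}(G(\widehat{x}))$, the convex cone containing the origin generated by $G(\widehat{x})$ (equal to $\{0_n\}$ if $G(\widehat{x})=\emptyset$); $N(S,\widehat{x})$ is the normal cone of convex analysis to $S$ at $\widehat{x}$, i.e. $\{u\mid u'(x-\widehat{x})\le0\ \forall x\in S\}$. LFMCQ holds at $\widehat{x}$ when $N(S,\widehat{x})=G_\ast(\widehat{x})$.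 The weak KKT condition holds at $\widehat{x}\in S$ when there exist $\alpha_i\ge0$ ($i\in I$) with $\sum_{i=1}^p\alpha_i=1$, and $\beta_t\ge0$ ($t\in T(\widehat{x})$), with $\beta_t\neq0$ for finitely many indices only, such that $0_n\in\sum_{i=1}^p\alpha_i\partial f_i(\widehat{x})+\sum_{t\in T(\widehat{x})}\beta_t\partial g_t(\widehat{x})$. *)

theory Defs
  imports "HOL-Analysis.Analysis"
begin

text \<open>The convention \<open>0 * \<infinity> = 0\<close> of \<^typ>\<open>ereal\<close> makes the cases \<open>u = 0\<close> and \<open>v = 0\<close>
  trivial.\<close>

definition convex_ereal :: "('a::real_vector \<Rightarrow> ereal) \<Rightarrow> bool" where
  "convex_ereal h \<longleftrightarrow>
     (\<forall>x y. \<forall>u\<ge>0. \<forall>v\<ge>0. u + v = 1 \<longrightarrow>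
        h (u *\<^sub>R x + v *\<^sub>R y) \<le> ereal u * h x + ereal v * h y)"

definition proper_ereal :: "('a \<Rightarrow> ereal) \<Rightarrow> bool" where
  "proper_ereal h \<longleftrightarrow> (\<forall>x. h x \<noteq> -\<infinity>) \<and> (\<exists>x. h x \<noteq> \<infinity>)"

text \<open>The filter \<^term>\<open>at x\<close> omits \<^term>\<open>x\<close> itself, which makes no difference to
  the inequality below.\<close>

definition lower_semicont :: "('a::topological_space \<Rightarrow> ereal) \<Rightarrow> bool" where
  "lower_semicont h \<longleftrightarrow> (\<forall>x. h x \<le> Liminf (at x) h)"

text \<open>Fenchel--Moreau subdifferential, empty wherever the function is not finite.\<close>

definition subdifferential :: "('a::real_inner \<Rightarrow> ereal) \<Rightarrow> 'a \<Rightarrow> 'a set" where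
  "subdifferential h x =
     {u. \<bar>h x\<bar> \<noteq> \<infinity> \<and> (\<forall>y. h x + ereal (u \<bullet> (y - x)) \<le> h y)}"

definition normal_cone :: "'a::real_inner set \<Rightarrow> 'a \<Rightarrow> 'a set" where
  "normal_cone S x = {u. \<forall>y\<in>S. u \<bullet> (y - x) \<le> 0}"

definition feasible_set :: "'t set \<Rightarrow> ('t \<Rightarrow> 'a \<Rightarrow> ereal) \<Rightarrow> 'a set" where
  "feasible_set T g = {x. \<forall>t\<in>T. g t x \<le> 0}"

definition weak_efficient ::
  "nat \<Rightarrow> (nat \<Rightarrow> 'a \<Rightarrow> real) \<Rightarrow> 't set \<Rightarrow> ('t \<Rightarrow> 'a \<Rightarrow> ereal) \<Rightarrow> 'a \<Rightarrow> bool" where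
  "weak_efficient p f T g xh \<longleftrightarrow>
     xh \<in> feasible_set T g \<and>
     \<not> (\<exists>x\<in>feasible_set T g. \<forall>i\<in>{1..p}. f i x < f i xh)"

definition active_set :: "'t set \<Rightarrow> ('t \<Rightarrow> 'a \<Rightarrow> ereal) \<Rightarrow> 'a \<Rightarrow> 't set" where
  "active_set T g xh = {t\<in>T. g t xh = 0}"

definition active_subgradients ::
  "'t set \<Rightarrow> ('t \<Rightarrow> 'a::real_inner \<Rightarrow> ereal) \<Rightarrow> 'a \<Rightarrow> 'a set" where
  "active_subgradients T g xh = (\<Union>t\<in>active_set T g xh. subdifferential (g t) xh)"

text \<open>The library predicate \<^const>\<open>convex_cone\<close> requires nonemptiness, so its hull
  always contains the origin and the hull of the empty set is the zero subspace.\<close>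

definition LFMCQ :: "'t set \<Rightarrow> ('t \<Rightarrow> 'a::real_inner \<Rightarrow> ereal) \<Rightarrow> 'a \<Rightarrow> bool" where
  "LFMCQ T g xh \<longleftrightarrow>
     normal_cone (feasible_set T g) xh = convex_cone hull (active_subgradients T g xh)"

text \<open>Sums of sets are Minkowski sums, with empty sum \<open>{0}\<close>. The sum over the
  possibly infinite active set is the sum over the finite support of the multipliers, so
  an active constraint with empty subdifferential and zero multiplier is ignored.\<close>

definition weak_KKT ::
  "nat \<Rightarrow> (nat \<Rightarrow> 'a::real_inner \<Rightarrow> real) \<Rightarrow> 't set \<Rightarrow> ('t \<Rightarrow> 'a \<Rightarrow> ereal) \<Rightarrow> 'a \<Rightarrow> bool" where
  "weak_KKT p f T g xh \<longleftrightarrow>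
     (\<exists>(\<alpha>::nat \<Rightarrow> real) (\<beta>::'t \<Rightarrow> real).
        (\<forall>i\<in>{1..p}. 0 \<le> \<alpha> i) \<and> (\<Sum>i=1..p. \<alpha> i) = 1 \<and>
        (\<forall>t\<in>active_set T g xh. 0 \<le> \<beta> t) \<and>
        finite {t\<in>active_set T g xh. \<beta> t \<noteq> 0} \<and>
        0 \<in> (\<Sum>i=1..p. (\<lambda>u. \<alpha> i *\<^sub>R u) ` subdifferential (\<lambda>x. ereal (f i x)) xh)
          + (\<Sum>t\<in>{t\<in>active_set T g xh. \<beta> t \<noteq> 0}. (\<lambda>u. \<beta> t *\<^sub>R u) ` subdifferential (g t) xh))"

end

theory Submission
  imports Defs
begin

text \<open>
  Sufficiency is weak duality: at a feasible point that improves every objective, the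
  linear functional given by the left-hand side of the KKT inclusion would be negative,
  and yet it is zero (\<open>weak_KKT_imp_weak_efficient\<close>).

  For necessity, \<open>xh\<close> is a weak efficient solution exactly when it minimises the single
  convex function \<open>F x = (MAX i. f i x - f i xh)\<close> over the feasible set \<open>S\<close>, because
  \<open>F xh = 0\<close> and \<open>F x < 0\<close> means that every objective improves. Separating the strict
  epigraph of \<open>F\<close> from \<open>S \<times> {0}\<close> gives a subgradient \<open>u\<close> of \<open>F\<close> at \<open>xh\<close> with \<open>- u\<close> in the
  normal cone of \<open>S\<close> (\<open>constrained_minimum_subgradient\<close>).
  Every subgradient of such a maximum is a convex combination of subgradients of the
  \<open>f i\<close> (\<open>subdifferential_Max_subset\<close>), which yields the multipliers \<open>\<alpha>\<close>.
  The constraint qualification places \<open>- u\<close> in the cone generated by the active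
  subgradients; as each subdifferential is convex, the terms that belong to the same
  constraint merge into one (\<open>convex_cone_hull_UN_subset\<close>), which yields the
  multipliers \<open>\<beta>\<close>.
\<close>

section \<open>Subdifferentials\<close>

lemma subdifferential_real:
  "subdifferential (\<lambda>x. ereal (f x)) x0 = {u. \<forall>y. f x0 + u \<bullet> (y - x0) \<le> f y}"
  by (simp add: subdifferential_def)

lemma convex_subdifferential: "convex (subdifferential h x)"
proof (rule convexI)
  fix a b :: 'a and u v :: real
  assume a: "a \<in> subdifferential h x" and b: "b \<in> subdifferential h x"
    and uv: "0 \<le> u" "0 \<le> v" "u + v = 1"
  from a obtain r where r: "h x = ereal r"
    by (auto simp: subdifferential_def)
  have "ereal r + ereal ((u *\<^sub>R a + v *\<^sub>R b) \<bullet> (y - x)) \<le> h y" for y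
  proof -
    have "ereal r + ereal (a \<bullet> (y - x)) \<le> h y" "ereal r + ereal (b \<bullet> (y - x)) \<le> h y"
      using a b r by (auto simp: subdifferential_def)
    \<comment> \<open>Passing to the larger of the two slopes avoids weighting \<open>h y\<close>, which may be infinite.\<close>
    moreover have "u * (a \<bullet> (y - x)) + v * (b \<bullet> (y - x)) \<le> max (a \<bullet> (y - x)) (b \<bullet> (y - x))"
      using uv by (intro convex_bound_le) auto
    ultimately show ?thesis
      by (cases "h y") (auto simp: inner_add_left)
  qed
  then show "u *\<^sub>R a + v *\<^sub>R b \<in> subdifferential h x"
    by (simp add: subdifferential_def r)
qed

text \<open>Closedness holds because the set is an intersection of half-spaces. If \<open>f\<close> is at
  most \<open>M\<close> on the unit ball around \<open>x0\<close>, the subgradient inequality in the direction of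
  \<open>u\<close> itself gives \<open>norm u \<le> M - f x0\<close>.\<close>

lemma compact_subdifferential:
  fixes f :: "'a::euclidean_space \<Rightarrow> real"
  assumes "convex_on UNIV f"
  shows "compact (subdifferential (\<lambda>x. ereal (f x)) x0)"
proof -
  have "continuous_on (cball x0 1) f"
    using convex_on_continuous[OF open_UNIV assms] continuous_on_subset by blast
  then have "bounded (f ` cball x0 1)"
    by (intro compact_imp_bounded compact_continuous_image) auto
  then obtain M where M: "\<And>x. x \<in> cball x0 1 \<Longrightarrow> \<bar>f x\<bar> \<le> M"
    unfolding bounded_iff by (metis imageI real_norm_def)
  have "norm u \<le> M - f x0" if u: "u \<in> subdifferential (\<lambda>x. ereal (f x)) x0" for u
  proof (cases "u = 0")
    case True
    with M[of x0] show ?thesis by auto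
  next
    case False
    have "f x0 + u \<bullet> sgn u \<le> f (x0 + sgn u)"
      using u by (force simp: subdifferential_real dest: spec[of _ "x0 + sgn u"])
    moreover have "f (x0 + sgn u) \<le> M"
      using M[of "x0 + sgn u"] False by (simp add: dist_norm norm_sgn)
    moreover have "u \<bullet> sgn u = norm u"
      using False by (simp add: sgn_div_norm dot_square_norm power2_eq_square)
    ultimately show ?thesis by simp
  qed
  then have "bounded (subdifferential (\<lambda>x. ereal (f x)) x0)"
    by (auto intro: boundedI)
  moreover have "closed {u. \<forall>y. f x0 + u \<bullet> (y - x0) \<le> f y}"
    by (intro closed_Collect_all closed_Collect_le continuous_intros)
  ultimately show ?thesis
    by (simp add: compact_eq_bounded_closed subdifferential_real)
qed

section \<open>Convex minimisation over a convex set\<close>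

text \<open>The hyperplane that separates the strict epigraph of \<open>F\<close> from \<open>S \<times> {F x0}\<close> cannot
  be vertical, since the epigraph projects onto the whole space. It is therefore the
  graph of an affine function, whose slope \<open>u\<close> is a subgradient because it lies below the
  epigraph, and an inward normal because it lies above \<open>S \<times> {F x0}\<close>.\<close>

lemma constrained_minimum_subgradient:
  fixes F :: "'a::euclidean_space \<Rightarrow> real"
  assumes F: "convex_on UNIV F" and S: "convex S" "x0 \<in> S"
    and min: "\<And>x. x \<in> S \<Longrightarrow> F x0 \<le> F x"
  obtains u where "u \<in> subdifferential (\<lambda>x. ereal (F x)) x0" "- u \<in> normal_cone S x0"
proof -
  let ?E = "{(x, z). F x < z}" and ?B = "S \<times> {F x0}"
  have "convex ?E"
  proof (rule convexI, clarsimp)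
    fix x y and z w u v :: real
    assume *: "F x < z" "F y < w" "0 \<le> u" "0 \<le> v" "u + v = 1"
    have "F (u *\<^sub>R x + v *\<^sub>R y) \<le> u * F x + v * F y"
      using F * by (simp add: convex_on_def)
    also have "\<dots> < u * z + v * w"
    proof (cases "u = 0")
      case False
      then have "u * F x < u * z" "v * F y \<le> v * w"
        using * by (auto intro: mult_left_mono)
      then show ?thesis by simp
    qed (use * in auto)
    finally show "F (u *\<^sub>R x + v *\<^sub>R y) < u * z + v * w" .
  qed
  moreover have "convex ?B" "?B \<noteq> {}" "?E \<inter> ?B = {}"
    using S by (auto intro: convex_Times dest: min)
  moreover have "(x0, F x0 + 1) \<in> ?E" by simp
  then have "?E \<noteq> {}" by blast
  ultimately obtain ac b where "ac \<noteq> 0"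
    and "\<forall>e\<in>?E. ac \<bullet> e \<le> b" "\<forall>e\<in>?B. ac \<bullet> e \<ge> b"
    using separating_hyperplane_sets[of ?E ?B] by metis
  moreover obtain a c where "ac = (a, c)" by fastforce
  ultimately have nz: "(a, c) \<noteq> 0"
    and below: "\<And>x z. F x < z \<Longrightarrow> a \<bullet> x + c * z \<le> b"
    and above: "\<And>y. y \<in> S \<Longrightarrow> b \<le> a \<bullet> y + c * F x0"
    by auto
  have "c \<noteq> 0"
  proof
    assume "c = 0"
    then have "a \<bullet> (x0 + a) \<le> a \<bullet> x0"
      using below[of "x0 + a" "F (x0 + a) + 1"] above[OF S(2)] by simp
    then have "a = 0"
      by (simp add: inner_add_right) (metis inner_gt_zero_iff not_le)
    with nz \<open>c = 0\<close> show False by (simp add: zero_prod_def)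
  qed
  moreover have "c \<le> 0"
    using below[of x0 "F x0 + 1"] above[OF S(2)] by (simp add: algebra_simps)
  ultimately have c: "c < 0" by simp
  have graph: "a \<bullet> x + c * F x \<le> b" for x
  proof (rule field_le_epsilon)
    fix e :: real assume "0 < e"
    then have "F x < F x - e / c"
      using c by (simp add: divide_pos_neg)
    from below[OF this] show "a \<bullet> x + c * F x \<le> b + e"
      using c by (simp add: right_diff_distrib)
  qed
  define u where "u = (1 / - c) *\<^sub>R a"
  have a: "a = (- c) *\<^sub>R u"
    using c by (simp add: u_def)
  have key: "(- c) * (u \<bullet> x - F x) \<le> (- c) * (u \<bullet> y - F x0)" if "y \<in> S" for x y
    using graph[of x] above[OF that] by (simp add: a algebra_simps)
  have "u \<bullet> x - F x \<le> u \<bullet> y - F x0" if "y \<in> S" for x y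
    using key[OF that, of x] c by (simp only: mult_le_cancel_left_pos neg_0_less_iff_less)
  from this[OF S(2)] this[of _ x0] show thesis
    by (intro that[of u])
       (simp_all add: subdifferential_real normal_cone_def inner_diff_right algebra_simps)
qed

lemma subdifferential_nonempty:
  fixes f :: "'a::euclidean_space \<Rightarrow> real"
  assumes "convex_on UNIV f"
  shows "subdifferential (\<lambda>x. ereal (f x)) x0 \<noteq> {}"
  using constrained_minimum_subgradient[OF assms, of "{x0}" x0] by auto

section \<open>Finite maxima of convex functions\<close>

lemma convex_on_Max:
  assumes "finite I" "I \<noteq> {}" "\<And>i. i \<in> I \<Longrightarrow> convex_on UNIV (f i)"
  shows "convex_on UNIV (\<lambda>x. MAX i\<in>I. f i x :: real)"
  unfolding convex_on_def
proof (intro conjI convex_UNIV ballI allI impI)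
  fix x y and u v :: real
  assume uv: "0 \<le> u" "0 \<le> v" "u + v = 1"
  have "f i (u *\<^sub>R x + v *\<^sub>R y) \<le> u * (MAX i\<in>I. f i x) + v * (MAX i\<in>I. f i y)"
    if i: "i \<in> I" for i
  proof -
    have "f i (u *\<^sub>R x + v *\<^sub>R y) \<le> u * f i x + v * f i y"
      using assms(3)[OF i] uv by (simp add: convex_on_def)
    also have "\<dots> \<le> u * (MAX i\<in>I. f i x) + v * (MAX i\<in>I. f i y)"
      using assms(1) i uv by (intro add_mono mult_left_mono Max_ge) auto
    finally show ?thesis .
  qed
  then show "(MAX i\<in>I. f i (u *\<^sub>R x + v *\<^sub>R y))
      \<le> u * (MAX i\<in>I. f i x) + v * (MAX i\<in>I. f i y)"
    using assms(1,2) by simp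
qed

text \<open>The hypothesis says that \<open>x0\<close> minimises \<open>\<lambda>x. f x - q \<bullet> x\<close> over the ray from \<open>x0\<close>
  along \<open>d\<close>. A subgradient \<open>w\<close> of this function with \<open>- w\<close> normal to the ray satisfies
  \<open>0 \<le> w \<bullet> d\<close>, and \<open>w + q\<close> is the subgradient of \<open>f\<close>. This is the nontrivial half of the
  formula that expresses the directional derivative as a maximum over subgradients.\<close>

lemma subgradient_in_direction:
  fixes f :: "'a::euclidean_space \<Rightarrow> real"
  assumes f: "convex_on UNIV f"
    and ray: "\<And>t. 0 < t \<Longrightarrow> f x0 + t * (q \<bullet> d) \<le> f (x0 + t *\<^sub>R d)"
  obtains u where "u \<in> subdifferential (\<lambda>x. ereal (f x)) x0" "q \<bullet> d \<le> u \<bullet> d"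
proof -
  let ?R = "(\<lambda>t. x0 + t *\<^sub>R d) ` {0..}"
  have "convex_on UNIV (\<lambda>x. f x - q \<bullet> x)"
    using f by (auto simp: convex_on_def inner_add_right algebra_simps)
  moreover have "convex ?R"
  proof (rule convexI)
    fix x y and u v :: real
    assume "x \<in> ?R" "y \<in> ?R" and uv: "0 \<le> u" "0 \<le> v" "u + v = 1"
    then obtain s t where st: "0 \<le> s" "0 \<le> t" "x = x0 + s *\<^sub>R d" "y = x0 + t *\<^sub>R d"
      by auto
    have "u *\<^sub>R x + v *\<^sub>R y = (u + v) *\<^sub>R x0 + (u * s + v * t) *\<^sub>R d"
      by (simp add: st algebra_simps)
    then show "u *\<^sub>R x + v *\<^sub>R y \<in> ?R"
      using uv st by auto
  qed
  moreover have "x0 \<in> ?R"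
    by (auto intro: image_eqI[of _ _ 0])
  moreover have "f x0 - q \<bullet> x0 \<le> f x - q \<bullet> x" if "x \<in> ?R" for x
  proof -
    from that obtain t where "0 \<le> t" "x = x0 + t *\<^sub>R d" by auto
    then show ?thesis
      using ray[of t] by (cases "t = 0") (auto simp: inner_add_right)
  qed
  ultimately obtain w where
    w: "w \<in> subdifferential (\<lambda>x. ereal (f x - q \<bullet> x)) x0" "- w \<in> normal_cone ?R x0"
    using constrained_minimum_subgradient by blast
  have "x0 + d \<in> ?R" by (auto intro: image_eqI[of _ _ 1])
  with w(2) have "- w \<bullet> (x0 + d - x0) \<le> 0"
    unfolding normal_cone_def by blast
  then have "0 \<le> w \<bullet> d" by simp
  moreover have "w + q \<in> subdifferential (\<lambda>x. ereal (f x)) x0"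
    using w(1) by (auto simp: subdifferential_real inner_add_left inner_diff_right algebra_simps)
  ultimately show thesis
    by (intro that[of "w + q"]) (auto simp: inner_add_left)
qed

text \<open>If a subgradient \<open>q\<close> of the maximum were outside the compact convex hull \<open>C\<close>, some
  direction \<open>d\<close> would satisfy \<open>u \<bullet> d < q \<bullet> d\<close> for all \<open>u\<close> in \<open>C\<close>. Then no \<open>f i\<close> can grow
  along \<open>d\<close> at rate at least \<open>q \<bullet> d\<close>, so each of them is strictly below this rate at some
  step, hence by convexity at all shorter steps. At the smallest of these steps the maximum
  is below it too, contradicting the choice of \<open>q\<close>.\<close>

lemma subdifferential_Max_subset:
  fixes f :: "'i \<Rightarrow> 'a::euclidean_space \<Rightarrow> real"
  assumes I: "finite I" "I \<noteq> {}"
    and f: "\<And>i. i \<in> I \<Longrightarrow> convex_on UNIV (f i)"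
    and zero: "\<And>i. i \<in> I \<Longrightarrow> f i x0 = 0"
  shows "subdifferential (\<lambda>x. ereal (MAX i\<in>I. f i x)) x0
    \<subseteq> convex hull (\<Union>i\<in>I. subdifferential (\<lambda>x. ereal (f i x)) x0)"
    (is "_ \<subseteq> ?C")
proof (rule subsetI, rule ccontr)
  fix q assume q: "q \<in> subdifferential (\<lambda>x. ereal (MAX i\<in>I. f i x)) x0" and "q \<notin> ?C"
  have "compact ?C"
    using I f by (intro compact_convex_hull compact_UN compact_subdifferential) auto
  then obtain a b where "a \<bullet> q < b" "\<And>u. u \<in> ?C \<Longrightarrow> b < a \<bullet> u"
    using separating_hyperplane_closed_point[of ?C q] \<open>q \<notin> ?C\<close>
    by (meson compact_imp_closed convex_convex_hull)
  moreover define d where "d = - a"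
  ultimately have d: "u \<bullet> d < q \<bullet> d" if "u \<in> ?C" for u
    using that by (force simp: inner_commute)
  have "\<exists>t>0. f i (x0 + t *\<^sub>R d) < t * (q \<bullet> d)" if i: "i \<in> I" for i
  proof (rule ccontr)
    assume "\<not> ?thesis"
    then obtain u where "u \<in> subdifferential (\<lambda>x. ereal (f i x)) x0" "q \<bullet> d \<le> u \<bullet> d"
      using zero[OF i] subgradient_in_direction[OF f[OF i], of x0 q d]
      by (metis add_0 not_less)
    with d[of u] i hull_inc[of u "\<Union>i\<in>I. subdifferential (\<lambda>x. ereal (f i x)) x0" convex]
    show False by fastforce
  qed
  then obtain t where t: "\<And>i. i \<in> I \<Longrightarrow> 0 < t i"
    "\<And>i. i \<in> I \<Longrightarrow> f i (x0 + t i *\<^sub>R d) < t i * (q \<bullet> d)"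
    by metis
  define s where "s = (MIN i\<in>I. t i)"
  have "0 < s"
    using I t by (simp add: s_def)
  have "f i (x0 + s *\<^sub>R d) < s * (q \<bullet> d)" if i: "i \<in> I" for i
  proof -
    define c where "c = s / t i"
    have "s \<le> t i"
      using I i by (simp add: s_def)
    then have c: "0 < c" "c \<le> 1" "s = c * t i"
      using t(1)[OF i] \<open>0 < s\<close> by (auto simp: c_def)
    have "x0 + s *\<^sub>R d = (1 - c) *\<^sub>R x0 + c *\<^sub>R (x0 + t i *\<^sub>R d)"
      by (simp add: c algebra_simps)
    then have "f i (x0 + s *\<^sub>R d) \<le> (1 - c) * f i x0 + c * f i (x0 + t i *\<^sub>R d)"
      using f[OF i] c unfolding convex_on_def by simp
    also have "\<dots> < c * (t i * (q \<bullet> d))"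
      using t(2)[OF i] c zero[OF i] by simp
    finally show ?thesis by (simp add: c)
  qed
  then have "(MAX i\<in>I. f i (x0 + s *\<^sub>R d)) < s * (q \<bullet> d)"
    using I by simp
  moreover have "(MAX i\<in>I. f i x0) = 0"
    using I zero by simp
  ultimately show False
    using q by (force simp: subdifferential_real dest: spec[of _ "x0 + s *\<^sub>R d"])
qed

section \<open>Cones generated by a union\<close>

lemma convex_cone_hull_UN_subset:
  "convex_cone hull (\<Union>t\<in>A. D t)
    \<subseteq> {\<Sum>t\<in>B. w t | B w. finite B \<and> B \<subseteq> A \<and> (\<forall>t\<in>B. w t \<in> convex_cone hull D t)}"
    (is "_ \<subseteq> ?K")
proof (rule hull_minimal)
  show "(\<Union>t\<in>A. D t) \<subseteq> ?K"
  proof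
    fix x assume "x \<in> (\<Union>t\<in>A. D t)"
    then obtain t where "t \<in> A" "x \<in> D t" by blast
    then show "x \<in> ?K"
      by (auto intro!: exI[of _ "{t}"] exI[of _ "\<lambda>_. x"] hull_inc)
  qed
  show "convex_cone ?K"
  proof (rule convex_cone_iff[THEN iffD2], intro conjI ballI allI impI)
    show "0 \<in> ?K"
      by (auto intro: exI[of _ "{}"])
  next
    fix x and c :: real
    assume "x \<in> ?K" "0 \<le> c"
    then obtain B w where B: "finite B" "B \<subseteq> A" "\<forall>t\<in>B. w t \<in> convex_cone hull D t"
      and x: "x = (\<Sum>t\<in>B. w t)"
      by blast
    show "c *\<^sub>R x \<in> ?K"
      using B \<open>0 \<le> c\<close> unfolding x
      by (auto intro!: exI[of _ B] exI[of _ "\<lambda>t. c *\<^sub>R w t"] convex_cone_hull_mul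
          simp: scaleR_sum_right)
  next
    fix x y assume "x \<in> ?K" "y \<in> ?K"
    then obtain B w B' w' where
      B: "finite B" "B \<subseteq> A" "\<forall>t\<in>B. w t \<in> convex_cone hull D t"
      and B': "finite B'" "B' \<subseteq> A" "\<forall>t\<in>B'. w' t \<in> convex_cone hull D t"
      and xy: "x = (\<Sum>t\<in>B. w t)" "y = (\<Sum>t\<in>B'. w' t)"
      by blast
    \<comment> \<open>The two sums run over different index sets; both are extended by zero to the union.\<close>
    define v where "v t = (if t \<in> B then w t else 0) + (if t \<in> B' then w' t else 0)" for t
    have "x = (\<Sum>t\<in>B \<union> B'. if t \<in> B then w t else 0)"
      unfolding xy using B(1) B'(1) by (intro sum.mono_neutral_cong_left) auto
    moreover have "y = (\<Sum>t\<in>B \<union> B'. if t \<in> B' then w' t else 0)"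
      unfolding xy using B(1) B'(1) by (intro sum.mono_neutral_cong_left) auto
    ultimately have "x + y = (\<Sum>t\<in>B \<union> B'. v t)"
      by (simp add: v_def sum.distrib)
    moreover have "\<forall>t\<in>B \<union> B'. v t \<in> convex_cone hull D t"
      using B(3) B'(3) by (auto simp: v_def intro: convex_cone_hull_add)
    ultimately show "x + y \<in> ?K"
      using B(1,2) B'(1,2) by (auto intro!: exI[of _ "B \<union> B'"] exI[of _ v])
  qed
qed

text \<open>For convex generating sets the cone over each of them is reached by rescaling a single
  element, so the elements of the generated cone are described by one multiplier and one
  generator per index.\<close>

lemma convex_cone_hull_UN_multipliers:
  assumes "x \<in> convex_cone hull (\<Union>t\<in>A. D t)" "\<And>t. t \<in> A \<Longrightarrow> convex (D t)"
  obtains \<beta> v where "\<And>t. 0 \<le> \<beta> t" "finite {t\<in>A. \<beta> t \<noteq> 0}"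
    "\<And>t. t \<in> {t\<in>A. \<beta> t \<noteq> 0} \<Longrightarrow> v t \<in> D t"
    "x = (\<Sum>t\<in>{t\<in>A. \<beta> t \<noteq> 0}. \<beta> t *\<^sub>R v t)"
proof -
  obtain B w where B: "finite B" "B \<subseteq> A" and w: "\<And>t. t \<in> B \<Longrightarrow> w t \<in> convex_cone hull D t"
    and x: "x = (\<Sum>t\<in>B. w t)"
    using subsetD[OF convex_cone_hull_UN_subset assms(1)] by auto
  have "\<exists>c v. 0 \<le> c \<and> (c \<noteq> 0 \<longrightarrow> t \<in> B \<and> v \<in> D t) \<and> (t \<in> B \<longrightarrow> w t = c *\<^sub>R v)" for t
  proof (cases "t \<in> B \<and> w t \<noteq> 0")
    case True
    then have "w t \<in> conic hull D t"
      using w[of t] assms(2)[of t] B(2)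
      by (auto simp: convex_cone_hull_separate hull_same)
    then show ?thesis
      using True by (auto simp: conic_hull_explicit)
  next
    case False
    then show ?thesis by (auto intro: exI[of _ 0])
  qed
  then obtain \<beta> v where \<beta>: "\<And>t. 0 \<le> \<beta> t" "\<And>t. \<beta> t \<noteq> 0 \<Longrightarrow> t \<in> B \<and> v t \<in> D t"
    "\<And>t. t \<in> B \<Longrightarrow> w t = \<beta> t *\<^sub>R v t"
    by metis
  have support: "{t\<in>A. \<beta> t \<noteq> 0} \<subseteq> B"
    using \<beta>(2) by auto
  have "x = (\<Sum>t\<in>{t\<in>A. \<beta> t \<noteq> 0}. \<beta> t *\<^sub>R v t)"
    unfolding x using B \<beta>(2,3) by (intro sum.mono_neutral_cong_right) auto
  with \<beta> support B(1) show thesis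
    by (intro that[of \<beta> v]) (auto intro: finite_subset)
qed

section \<open>The weak KKT condition\<close>

lemma convex_feasible_set:
  assumes "\<And>t. t \<in> T \<Longrightarrow> convex_ereal (g t)"
  shows "convex (feasible_set T g)"
proof (rule convexI)
  fix x y and u v :: real
  assume x: "x \<in> feasible_set T g" and y: "y \<in> feasible_set T g"
    and uv: "0 \<le> u" "0 \<le> v" "u + v = 1"
  have "g t (u *\<^sub>R x + v *\<^sub>R y) \<le> 0" if t: "t \<in> T" for t
  proof -
    have "g t (u *\<^sub>R x + v *\<^sub>R y) \<le> ereal u * g t x + ereal v * g t y"
      using assms[OF t] uv by (simp add: convex_ereal_def)
    also have "\<dots> \<le> ereal u * 0 + ereal v * 0"
      using x y t uv by (intro add_mono ereal_mult_left_mono) (auto simp: feasible_set_def)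
    finally show ?thesis by simp
  qed
  then show "u *\<^sub>R x + v *\<^sub>R y \<in> feasible_set T g"
    by (simp add: feasible_set_def)
qed

lemma mem_sum_scaleR_images_iff:
  fixes D :: "'i \<Rightarrow> 'a::real_vector set"
  assumes "finite I"
  shows "x \<in> (\<Sum>i\<in>I. (\<lambda>u. c i *\<^sub>R u) ` D i)
    \<longleftrightarrow> (\<exists>u. (\<forall>i\<in>I. u i \<in> D i) \<and> x = (\<Sum>i\<in>I. c i *\<^sub>R u i))"
proof
  assume "x \<in> (\<Sum>i\<in>I. (\<lambda>u. c i *\<^sub>R u) ` D i)"
  then obtain s where s: "\<forall>i\<in>I. s i \<in> (\<lambda>u. c i *\<^sub>R u) ` D i" "x = sum s I"
    using assms by (auto simp: set_sum_alt)
  then have "\<forall>i\<in>I. \<exists>u. u \<in> D i \<and> s i = c i *\<^sub>R u" by blast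
  then obtain u where "\<forall>i\<in>I. u i \<in> D i \<and> s i = c i *\<^sub>R u i"
    by (auto simp: bchoice_iff)
  with s(2) show "\<exists>u. (\<forall>i\<in>I. u i \<in> D i) \<and> x = (\<Sum>i\<in>I. c i *\<^sub>R u i)"
    by (intro exI[of _ u]) (auto intro: sum.cong)
next
  assume "\<exists>u. (\<forall>i\<in>I. u i \<in> D i) \<and> x = (\<Sum>i\<in>I. c i *\<^sub>R u i)"
  then show "x \<in> (\<Sum>i\<in>I. (\<lambda>u. c i *\<^sub>R u) ` D i)"
    using assms by (auto simp: set_sum_alt)
qed

lemma zero_mem_sums_scaleR_images_iff:
  fixes D :: "'i \<Rightarrow> 'a::real_vector set" and E :: "'j \<Rightarrow> 'a set"
  assumes "finite I" "finite J"
  shows "0 \<in> (\<Sum>i\<in>I. (\<lambda>u. c i *\<^sub>R u) ` D i) + (\<Sum>j\<in>J. (\<lambda>u. d j *\<^sub>R u) ` E j)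
    \<longleftrightarrow> (\<exists>u v. (\<forall>i\<in>I. u i \<in> D i) \<and> (\<forall>j\<in>J. v j \<in> E j) \<and>
      (\<Sum>i\<in>I. c i *\<^sub>R u i) + (\<Sum>j\<in>J. d j *\<^sub>R v j) = 0)"
    (is "0 \<in> ?X + ?Y \<longleftrightarrow> _")
proof -
  have "0 \<in> ?X + ?Y \<longleftrightarrow> (\<exists>x y. x \<in> ?X \<and> y \<in> ?Y \<and> x + y = 0)"
    by (auto simp: set_plus_def eq_commute[of 0])
  also have "\<dots> \<longleftrightarrow> (\<exists>u v. (\<forall>i\<in>I. u i \<in> D i) \<and> (\<forall>j\<in>J. v j \<in> E j) \<and>
      (\<Sum>i\<in>I. c i *\<^sub>R u i) + (\<Sum>j\<in>J. d j *\<^sub>R v j) = 0)"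
    unfolding mem_sum_scaleR_images_iff[OF assms(1)] mem_sum_scaleR_images_iff[OF assms(2)]
    by blast
  finally show ?thesis .
qed

text \<open>Membership in the Minkowski sums amounts to the choice of one subgradient for each
  objective and one for each constraint in the support of the multipliers.\<close>

lemma weak_KKT_iff:
  "weak_KKT p f T g xh \<longleftrightarrow>
    (\<exists>\<alpha> \<beta> u v. (\<forall>i\<in>{1..p}. 0 \<le> \<alpha> i) \<and> (\<Sum>i=1..p. \<alpha> i) = 1 \<and>
      (\<forall>t\<in>active_set T g xh. 0 \<le> \<beta> t) \<and> finite {t\<in>active_set T g xh. \<beta> t \<noteq> 0} \<and>
      (\<forall>i\<in>{1..p}. u i \<in> subdifferential (\<lambda>x. ereal (f i x)) xh) \<and>
      (\<forall>t\<in>{t\<in>active_set T g xh. \<beta> t \<noteq> 0}. v t \<in> subdifferential (g t) xh) \<and>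
      (\<Sum>i=1..p. \<alpha> i *\<^sub>R u i) + (\<Sum>t\<in>{t\<in>active_set T g xh. \<beta> t \<noteq> 0}. \<beta> t *\<^sub>R v t) = 0)"
proof -
  let ?A = "active_set T g xh"
  have "0 \<in> (\<Sum>i=1..p. (\<lambda>u. \<alpha> i *\<^sub>R u) ` subdifferential (\<lambda>x. ereal (f i x)) xh)
        + (\<Sum>t\<in>{t\<in>?A. \<beta> t \<noteq> 0}. (\<lambda>u. \<beta> t *\<^sub>R u) ` subdifferential (g t) xh)
    \<longleftrightarrow> (\<exists>u v. (\<forall>i\<in>{1..p}. u i \<in> subdifferential (\<lambda>x. ereal (f i x)) xh) \<and>
      (\<forall>t\<in>{t\<in>?A. \<beta> t \<noteq> 0}. v t \<in> subdifferential (g t) xh) \<and>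
      (\<Sum>i=1..p. \<alpha> i *\<^sub>R u i) + (\<Sum>t\<in>{t\<in>?A. \<beta> t \<noteq> 0}. \<beta> t *\<^sub>R v t) = 0)"
    if "finite {t\<in>?A. \<beta> t \<noteq> 0}" for \<alpha> \<beta>
    by (rule zero_mem_sums_scaleR_images_iff[OF finite_atLeastAtMost that])
  then show ?thesis
    unfolding weak_KKT_def by (intro iff_exI) (simp only: ex_simps cong: conj_cong)
qed

lemma weak_KKT_imp_weak_efficient:
  assumes xh: "xh \<in> feasible_set T g" and KKT: "weak_KKT p f T g xh"
  shows "weak_efficient p f T g xh"
  unfolding weak_efficient_def
proof (intro conjI notI)
  let ?A = "active_set T g xh"
  assume "\<exists>x\<in>feasible_set T g. \<forall>i\<in>{1..p}. f i x < f i xh"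
  then obtain x where x: "x \<in> feasible_set T g" "\<And>i. i \<in> {1..p} \<Longrightarrow> f i x < f i xh"
    by blast
  obtain \<alpha> \<beta> u v where \<alpha>: "\<forall>i\<in>{1..p}. 0 \<le> \<alpha> i" "(\<Sum>i=1..p. \<alpha> i) = 1"
    and \<beta>: "\<forall>t\<in>?A. 0 \<le> \<beta> t"
    and u: "\<forall>i\<in>{1..p}. u i \<in> subdifferential (\<lambda>x. ereal (f i x)) xh"
    and v: "\<forall>t\<in>{t\<in>?A. \<beta> t \<noteq> 0}. v t \<in> subdifferential (g t) xh"
    and 0: "(\<Sum>i=1..p. \<alpha> i *\<^sub>R u i) + (\<Sum>t\<in>{t\<in>?A. \<beta> t \<noteq> 0}. \<beta> t *\<^sub>R v t) = 0"
    using KKT unfolding weak_KKT_iff by blast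
  \<comment> \<open>With \<open>x - xh\<close> as test direction, the objective part of the KKT equation is negative,
    as some \<open>\<alpha> j\<close> is nonzero, and the constraint part is at most zero.\<close>
  have descent: "u i \<bullet> (x - xh) < 0" if "i \<in> {1..p}" for i
  proof -
    have "f i xh + u i \<bullet> (x - xh) \<le> f i x"
      using u that by (simp add: subdifferential_real)
    with x(2)[OF that] show ?thesis by simp
  qed
  obtain j where j: "j \<in> {1..p}" "\<alpha> j \<noteq> 0"
    using \<alpha>(2) by (metis sum.neutral zero_neq_one)
  have "(\<Sum>i=1..p. \<alpha> i * (u i \<bullet> (x - xh))) < (\<Sum>i=1..p. 0)"
  proof (rule sum_strict_mono_ex1)
    show "\<forall>i\<in>{1..p}. \<alpha> i * (u i \<bullet> (x - xh)) \<le> 0"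
      using \<alpha>(1) descent by (force intro: mult_nonneg_nonpos)
    have "0 < \<alpha> j"
      using j \<alpha>(1) by (simp add: less_le)
    then show "\<exists>i\<in>{1..p}. \<alpha> i * (u i \<bullet> (x - xh)) < 0"
      using descent[OF j(1)] j(1) by (intro bexI[of _ j] mult_pos_neg) auto
  qed simp
  moreover have "(\<Sum>t\<in>{t\<in>?A. \<beta> t \<noteq> 0}. \<beta> t * (v t \<bullet> (x - xh))) \<le> 0"
  proof (rule sum_nonpos)
    fix t assume t: "t \<in> {t\<in>?A. \<beta> t \<noteq> 0}"
    then have "ereal (v t \<bullet> (x - xh)) \<le> g t x"
      using v by (auto simp: subdifferential_def active_set_def dest: spec[of _ x])
    also have "\<dots> \<le> 0"
      using x(1) t by (auto simp: feasible_set_def active_set_def)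
    finally show "\<beta> t * (v t \<bullet> (x - xh)) \<le> 0"
      using \<beta> t by (auto intro: mult_nonneg_nonpos)
  qed
  moreover have "(\<Sum>i=1..p. \<alpha> i * (u i \<bullet> (x - xh)))
      + (\<Sum>t\<in>{t\<in>?A. \<beta> t \<noteq> 0}. \<beta> t * (v t \<bullet> (x - xh))) = 0"
    using arg_cong[OF 0, of "\<lambda>z. z \<bullet> (x - xh)"] by (simp add: inner_add_left inner_sum_left)
  ultimately show False by simp
qed (rule xh)

text \<open>Shifting each objective to vanish at \<open>xh\<close> leaves its subdifferential unchanged and
  makes all of them active in the maximum. The subdifferentials are nonempty, so that a
  convex combination can use one subgradient of every objective, also where its weight is
  zero.\<close>

lemma weak_efficient_imp_normal_multipliers:
  fixes f :: "nat \<Rightarrow> 'a::euclidean_space \<Rightarrow> real"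
  assumes p: "1 \<le> p" and f: "\<And>i. i \<in> {1..p} \<Longrightarrow> convex_on UNIV (f i)"
    and S: "convex (feasible_set T g)" and eff: "weak_efficient p f T g xh"
  obtains \<alpha> u where "\<forall>i\<in>{1..p}. 0 \<le> \<alpha> i" "(\<Sum>i=1..p. \<alpha> i) = 1"
    "\<forall>i\<in>{1..p}. u i \<in> subdifferential (\<lambda>x. ereal (f i x)) xh"
    "- (\<Sum>i=1..p. \<alpha> i *\<^sub>R u i) \<in> normal_cone (feasible_set T g) xh"
proof -
  define h where "h i x = f i x - f i xh" for i x
  have h: "convex_on UNIV (h i)" if "i \<in> {1..p}" for i
    using f[OF that] unfolding h_def convex_on_def
    by (simp add: algebra_simps flip: distrib_right)
  have sub: "subdifferential (\<lambda>x. ereal (h i x)) xh = subdifferential (\<lambda>x. ereal (f i x)) xh" for i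
    by (simp add: subdifferential_real h_def algebra_simps)
  have h0: "h i xh = 0" for i
    by (simp add: h_def)
  let ?F = "\<lambda>x. MAX i\<in>{1..p}. h i x"
  have I: "finite {1..p}" "{1..p} \<noteq> {}"
    using p by auto
  have "?F xh = 0"
    using I by (simp add: h0)
  moreover have "0 \<le> ?F x" if "x \<in> feasible_set T g" for x
    using eff that I by (force simp: weak_efficient_def h_def Max_ge_iff not_less)
  ultimately obtain q where q: "q \<in> subdifferential (\<lambda>x. ereal (?F x)) xh"
    "- q \<in> normal_cone (feasible_set T g) xh"
    using constrained_minimum_subgradient[OF convex_on_Max[of _ h, OF I h] S, of xh] eff
    by (auto simp: weak_efficient_def)
  have "q \<in> convex hull (\<Union>i\<in>{1..p}. subdifferential (\<lambda>x. ereal (f i x)) xh)"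
    using subdifferential_Max_subset[of _ h xh, OF I h h0] q(1) unfolding sub by blast
  moreover have parts: "\<forall>i\<in>{1..p}. convex (subdifferential (\<lambda>x. ereal (f i x)) xh)
      \<and> subdifferential (\<lambda>x. ereal (f i x)) xh \<noteq> {}"
    using f by (blast intro: convex_subdifferential subdifferential_nonempty[THEN notE])
  ultimately obtain \<alpha> u where "q = (\<Sum>i=1..p. \<alpha> i *\<^sub>R u i)"
    "\<forall>i\<in>{1..p}. 0 \<le> \<alpha> i" "(\<Sum>i=1..p. \<alpha> i) = 1"
    "\<forall>i\<in>{1..p}. u i \<in> subdifferential (\<lambda>x. ereal (f i x)) xh"
    unfolding convex_hull_finite_union[OF I(1) parts] by blast
  with q(2) show thesis
    by (intro that) simp_all
qed

theorem corollary1: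
  fixes p :: nat
    and f :: "nat \<Rightarrow> real ^ 'n \<Rightarrow> real"
    and T :: "'t set"
    and g :: "'t \<Rightarrow> real ^ 'n \<Rightarrow> ereal"
    and xh :: "real ^ 'n"
  assumes "2 \<le> p"
    and "\<And>i. i \<in> {1..p} \<Longrightarrow> convex_on UNIV (f i)"
    and "infinite T"
    and "\<And>t. t \<in> T \<Longrightarrow> lower_semicont (g t)"
    and "\<And>t. t \<in> T \<Longrightarrow> proper_ereal (g t)"
    and "\<And>t. t \<in> T \<Longrightarrow> convex_ereal (g t)"
    and "feasible_set T g \<noteq> {}"
    and "xh \<in> feasible_set T g"
    and "LFMCQ T g xh"
  shows "weak_efficient p f T g xh \<longleftrightarrow> weak_KKT p f T g xh"
proof
  assume "weak_KKT p f T g xh"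
  then show "weak_efficient p f T g xh"
    by (rule weak_KKT_imp_weak_efficient[OF assms(8)])
next
  assume "weak_efficient p f T g xh"
  moreover have "1 \<le> p" using assms(1) by simp
  ultimately obtain \<alpha> u where \<alpha>: "\<forall>i\<in>{1..p}. 0 \<le> \<alpha> i" "(\<Sum>i=1..p. \<alpha> i) = 1"
    and u: "\<forall>i\<in>{1..p}. u i \<in> subdifferential (\<lambda>x. ereal (f i x)) xh"
    and "- (\<Sum>i=1..p. \<alpha> i *\<^sub>R u i) \<in> normal_cone (feasible_set T g) xh"
    using weak_efficient_imp_normal_multipliers[of p f T g xh] assms(2)
      convex_feasible_set[of T g] assms(6) by blast
  then have "- (\<Sum>i=1..p. \<alpha> i *\<^sub>R u i)
      \<in> convex_cone hull (\<Union>t\<in>active_set T g xh. subdifferential (g t) xh)"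
    using assms(9) by (simp add: LFMCQ_def active_subgradients_def)
  then obtain \<beta> v where \<beta>: "\<And>t. 0 \<le> \<beta> t" "finite {t\<in>active_set T g xh. \<beta> t \<noteq> 0}"
    and v: "\<And>t. t \<in> {t\<in>active_set T g xh. \<beta> t \<noteq> 0} \<Longrightarrow> v t \<in> subdifferential (g t) xh"
    and neg: "- (\<Sum>i=1..p. \<alpha> i *\<^sub>R u i)
      = (\<Sum>t\<in>{t\<in>active_set T g xh. \<beta> t \<noteq> 0}. \<beta> t *\<^sub>R v t)"
    by (rule convex_cone_hull_UN_multipliers) (auto intro: convex_subdifferential)
  have "(\<Sum>i=1..p. \<alpha> i *\<^sub>R u i)
      + (\<Sum>t\<in>{t\<in>active_set T g xh. \<beta> t \<noteq> 0}. \<beta> t *\<^sub>R v t) = 0"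
    by (simp flip: neg)
  with \<alpha> u \<beta> v show "weak_KKT p f T g xh"
    unfolding weak_KKT_iff by blast
qed

end
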